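(* Let $R=K[x_1,\dots,x_n]$ be a polynomial ring over a field $K$. A (nonzero, proper) monomial ideal $I\subset R$ is symmetric (i.e. $\mathfrak S_n$-fixed) and polymatroidal if and only if it is a symmetric strongly shifted ideal with exactly one partition Borel generator, i.e. $I=\mathrm{Sss}(\{\lambda\})$ for some $\lambda\in P_n$.
   Context: $\mathfrak S_n$ acts on $R$ by permuting variables. $P_n=\{\lambda\in\mathbb Z^n: 0\le\lambda_1\le\cdots\le\lambda_n\}$, $x^\lambda=x_1^{\lambda_1}\cdots x_n^{\lambda_n}$. For an $\mathfrak S_n$-fixed monomial ideal $I$ put $P(I)=\{\lambda\in P_n: x^\lambda\in I\}$. An $\mathfrak S_n$-fixed monomial ideal $I$ is symmetric strongly shifted if for every $\lambda\in P(I)$ and $1\le i<j\le n$ with $\lambda_i<\lambda_j$ one has $x^\lambda x_i/x_j\in I$. For $B\subseteq P_n$, $\mathrm{Sss}(B)$ is the smallest symmetric strongly shifted ideal containing $\{x^\lambda:\lambda\in B\}$. The set of partition Borel generators of a symmetric strongly shifted ideal $I$ is the smallest $B\subseteq P_n$ with $I=\mathrm{Sss}(B)$. A monomial ideal $I$ whose minimal monomial generators all have the same degree is polymatroidal if for any two minimal monomial generators $x^u,x^v$ of $I$ and every $i$ with $u_i>v_i$ there exists $j$ with $u_j<v_j$ and $x^u x_j/x_i\in I$. *)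

theory Defs
  imports Complex_Main "HOL-Library.Poly_Mapping"
begin

text \<open>
  The polynomial ring in finitely many ordered variables \<open>x\<^sub>i\<close>, \<open>i :: 'n\<close>, over the field \<open>'k\<close> is
  the full type \<open>('n \<Rightarrow>\<^sub>0 nat) \<Rightarrow>\<^sub>0 'k\<close> of finitely supported functions on exponent vectors.
  Thus \<open>n\<close> is \<open>CARD('n)\<close>, and the linear order on \<open>'n\<close> plays the role of \<open>1 < \<dots> < n\<close>.
\<close>

type_synonym 'n expo = "'n \<Rightarrow>\<^sub>0 nat"
type_synonym ('n, 'k) mpoly = "('n \<Rightarrow>\<^sub>0 nat) \<Rightarrow>\<^sub>0 'k"

definition xpow :: "'n expo \<Rightarrow> ('n, 'k::field) mpoly"
  where "xpow m = Poly_Mapping.single m 1"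

definition deg :: "'n::finite expo \<Rightarrow> nat"
  where "deg m = (\<Sum>i\<in>UNIV. Poly_Mapping.lookup m i)"

text \<open>
  The exponent of \<open>x\<^sup>m x\<^sub>i / x\<^sub>j\<close>. The subtraction is pointwise and truncated on \<open>nat\<close>, so this is
  only meaningful if \<open>x\<^sub>j\<close> divides \<open>x\<^sup>m x\<^sub>i\<close>.
\<close>

definition exchange :: "'n expo \<Rightarrow> 'n \<Rightarrow> 'n \<Rightarrow> 'n expo"
  where "exchange m i j = m + Poly_Mapping.single i 1 - Poly_Mapping.single j 1"

text \<open>
  Ideals are the submodules of the ring over itself; the span is the ideal generated by a set.
\<close>

global_interpretation poly_ideal: module "(*) :: ('n, 'k::field) mpoly \<Rightarrow> _ \<Rightarrow> _"
  defines is_ideal = poly_ideal.subspace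
    and ideal_of = poly_ideal.span
  by standard (simp_all add: algebra_simps)

definition monomial_ideal :: "('n, 'k::field) mpoly set \<Rightarrow> bool"
  where "monomial_ideal I \<longleftrightarrow> (\<exists>M. I = ideal_of (xpow ` M))"

text \<open>
  The \<open>K\<close>-algebra automorphism sending \<open>x\<^sub>i\<close> to \<open>x\<^bsub>\<sigma> i\<^esub>\<close>. Here \<open>map_key\<close> is precomposition, so the
  coefficient of \<open>x\<^sup>m\<close> in \<open>\<sigma> f\<close> is that of \<open>x\<^bsup>m \<circ> \<sigma>\<^esup>\<close> in \<open>f\<close>.
\<close>

definition permute_vars :: "('n \<Rightarrow> 'n) \<Rightarrow> ('n, 'k::field) mpoly \<Rightarrow> ('n, 'k) mpoly"
  where "permute_vars \<sigma> f = Poly_Mapping.map_key (Poly_Mapping.map_key \<sigma>) f"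

definition symmetric :: "('n, 'k::field) mpoly set \<Rightarrow> bool"
  where "symmetric I \<longleftrightarrow> (\<forall>\<sigma>. bij \<sigma> \<longrightarrow> permute_vars \<sigma> ` I = I)"

definition Pn :: "'n::linorder expo set"
  where "Pn = {\<mu>. mono (Poly_Mapping.lookup \<mu>)}"

definition partitions_of :: "('n::linorder, 'k::field) mpoly set \<Rightarrow> 'n expo set"
  where "partitions_of I = {\<mu> \<in> Pn. xpow \<mu> \<in> I}"

definition symmetric_strongly_shifted :: "('n::linorder, 'k::field) mpoly set \<Rightarrow> bool"
  where "symmetric_strongly_shifted I \<longleftrightarrow>
    monomial_ideal I \<and> symmetric I \<and>
    (\<forall>\<mu>\<in>partitions_of I. \<forall>i j. i < j \<and> Poly_Mapping.lookup \<mu> i < Poly_Mapping.lookup \<mu> j \<longrightarrow>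
      xpow (exchange \<mu> i j) \<in> I)"

text \<open>
  The hull is the intersection of all symmetric strongly shifted ideals containing the given
  monomials; it is the smallest one by \<open>symmetric_strongly_shifted_Sss\<close> below.
\<close>

definition Sss :: "'n::linorder expo set \<Rightarrow> ('n, 'k::field) mpoly set"
  where "Sss B = symmetric_strongly_shifted hull (xpow ` B)"

definition partition_Borel_generators ::
    "('n::linorder, 'k::field) mpoly set \<Rightarrow> 'n expo set"
  where "partition_Borel_generators I = (LEAST B. B \<subseteq> Pn \<and> I = Sss B)"

definition min_gens :: "('n, 'k::field) mpoly set \<Rightarrow> 'n expo set"
  where "min_gens I = {u. xpow u \<in> I \<and>
    (\<forall>v. xpow v \<in> I \<and> (xpow v :: ('n, 'k) mpoly) dvd xpow u \<longrightarrow> v = u)}"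

definition polymatroidal :: "('n::finite, 'k::field) mpoly set \<Rightarrow> bool"
  where "polymatroidal I \<longleftrightarrow>
    monomial_ideal I \<and>
    (\<forall>u\<in>min_gens I. \<forall>v\<in>min_gens I. deg u = deg v) \<and>
    (\<forall>u\<in>min_gens I. \<forall>v\<in>min_gens I.
      \<forall>i. Poly_Mapping.lookup v i < Poly_Mapping.lookup u i \<longrightarrow>
        (\<exists>j. Poly_Mapping.lookup u j < Poly_Mapping.lookup v j \<and> xpow (exchange u j i) \<in> I))"

lemma inj_map_key:
  assumes "bij \<sigma>"
  shows "inj (Poly_Mapping.map_key \<sigma> :: 'n expo \<Rightarrow> 'n expo)"
proof (rule injI)
  fix p q :: "'n expo"
  assume eq: "Poly_Mapping.map_key \<sigma> p = Poly_Mapping.map_key \<sigma> q"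
  show "p = q"
  proof (rule poly_mapping_eqI)
    fix k
    obtain i where k: "k = \<sigma> i"
      using assms by (metis bij_pointE)
    show "Poly_Mapping.lookup p k = Poly_Mapping.lookup q k"
      using arg_cong[OF eq, of "\<lambda>m. Poly_Mapping.lookup m i"] assms
      by (simp add: k bij_is_inj map_key.rep_eq)
  qed
qed

lemma lookup_permute_vars:
  assumes "bij \<sigma>"
  shows "Poly_Mapping.lookup (permute_vars \<sigma> f) m =
    Poly_Mapping.lookup f (Poly_Mapping.map_key \<sigma> m)"
  by (simp add: permute_vars_def map_key.rep_eq[OF inj_map_key[OF assms]])

lemma permute_vars_var:
  assumes "bij \<sigma>"
  shows "permute_vars \<sigma> (xpow (Poly_Mapping.single i 1)) = xpow (Poly_Mapping.single (\<sigma> i) 1)"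
  using map_key_single[OF inj_map_key[OF assms], of "Poly_Mapping.single (\<sigma> i) 1" 1]
  by (simp add: permute_vars_def xpow_def map_key_single[OF bij_is_inj[OF assms]])

lemma monomial_ideal_iff:
  fixes I :: "('n, 'k::field) mpoly set"
  shows "monomial_ideal I \<longleftrightarrow>
    is_ideal I \<and> (\<forall>f\<in>I. \<forall>m\<in>Poly_Mapping.keys f. xpow m \<in> I)"
proof
  assume "monomial_ideal I"
  then obtain M where I: "I = ideal_of (xpow ` M)"
    by (auto simp: monomial_ideal_def)
  have "\<exists>a\<in>M. \<exists>b. m = a + b" if "f \<in> I" "m \<in> Poly_Mapping.keys f" for f m
    using that unfolding I
  proof (induction f arbitrary: m rule: poly_ideal.span_induct_alt)
    case (step c x y)
    show ?case
    proof (cases "m \<in> Poly_Mapping.keys y")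
      case False
      then have "m \<in> Poly_Mapping.keys (c * x)"
        using step.prems Poly_Mapping.keys_add[of "c * x" y] by auto
      then have "m \<in> {a + b |a b. a \<in> Poly_Mapping.keys c \<and> b \<in> Poly_Mapping.keys x}"
        using keys_mult[of c x] by blast
      then show ?thesis
        using step.hyps by (fastforce simp: xpow_def add.commute split: if_splits)
    qed (use step in auto)
  qed auto
  moreover have "xpow (a + b) \<in> I" if "a \<in> M" for a b
  proof -
    have "xpow b * xpow a \<in> I"
      unfolding I by (intro poly_ideal.span_scale poly_ideal.span_base) (use that in auto)
    then show ?thesis
      by (simp add: xpow_def mult_single add.commute)
  qed
  ultimately show "is_ideal I \<and> (\<forall>f\<in>I. \<forall>m\<in>Poly_Mapping.keys f. xpow m \<in> I)"
    using poly_ideal.subspace_span I by metis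
next
  assume I: "is_ideal I \<and> (\<forall>f\<in>I. \<forall>m\<in>Poly_Mapping.keys f. xpow m \<in> I)"
  have "f \<in> ideal_of (xpow ` {m. xpow m \<in> I})" if "f \<in> I" for f
  proof -
    have "(\<Sum>m\<in>Poly_Mapping.keys f. Poly_Mapping.single 0 (Poly_Mapping.lookup f m) * xpow m)
      \<in> ideal_of (xpow ` {m. xpow m \<in> I})"
      using I that
      by (intro poly_ideal.span_sum poly_ideal.span_scale poly_ideal.span_base) auto
    also have "(\<Sum>m\<in>Poly_Mapping.keys f. Poly_Mapping.single 0 (Poly_Mapping.lookup f m) * xpow m)
      = f"
      by (rule poly_mapping_eqI)
        (auto simp: xpow_def mult_single lookup_sum lookup_single when_def in_keys_iff)
    finally show ?thesis .
  qed
  moreover have "ideal_of (xpow ` {m. xpow m \<in> I}) \<subseteq> I"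
    using I by (intro poly_ideal.span_minimal) auto
  ultimately show "monomial_ideal I"
    unfolding monomial_ideal_def by blast
qed

lemma bij_permute_vars:
  assumes "bij \<sigma>"
  shows "bij (permute_vars \<sigma> :: ('n, 'k::field) mpoly \<Rightarrow> _)"
proof -
  have inverse: "permute_vars \<alpha> (permute_vars \<beta> f) = f"
    if "bij \<alpha>" "bij \<beta>" "\<And>i. \<alpha> (\<beta> i) = i" for \<alpha> \<beta> :: "'n \<Rightarrow> 'n" and f :: "('n, 'k) mpoly"
  proof (rule poly_mapping_eqI)
    fix m :: "'n expo"
    have "Poly_Mapping.map_key \<beta> (Poly_Mapping.map_key \<alpha> m) = m"
      by (rule poly_mapping_eqI) (simp add: map_key.rep_eq bij_is_inj that)
    then show "Poly_Mapping.lookup (permute_vars \<alpha> (permute_vars \<beta> f)) m = Poly_Mapping.lookup f m"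
      by (simp add: lookup_permute_vars that)
  qed
  show ?thesis
    by (rule o_bij[where g = "permute_vars (inv_into UNIV \<sigma>)"])
      (simp_all add: fun_eq_iff inverse assms bij_imp_bij_inv bij_is_inj bij_is_surj surj_f_inv_f)
qed

lemma symmetric_iff:
  "symmetric I \<longleftrightarrow> (\<forall>\<sigma>. bij \<sigma> \<longrightarrow> (\<forall>f. permute_vars \<sigma> f \<in> I \<longleftrightarrow> f \<in> I))"
proof -
  have "permute_vars \<sigma> ` I = I \<longleftrightarrow> (\<forall>f. permute_vars \<sigma> f \<in> I \<longleftrightarrow> f \<in> I)" if \<sigma>: "bij \<sigma>" for \<sigma>
  proof
    assume "permute_vars \<sigma> ` I = I"
    then show "\<forall>f. permute_vars \<sigma> f \<in> I \<longleftrightarrow> f \<in> I"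
      using inj_image_mem_iff[OF bij_is_inj[OF bij_permute_vars[OF \<sigma>]]] by metis
  next
    assume *: "\<forall>f. permute_vars \<sigma> f \<in> I \<longleftrightarrow> f \<in> I"
    show "permute_vars \<sigma> ` I = I"
    proof (intro subset_antisym subsetI)
      fix g assume "g \<in> I"
      moreover obtain f where "g = permute_vars \<sigma> f"
        using bij_is_surj[OF bij_permute_vars[OF \<sigma>]] by (metis surjD)
      ultimately show "g \<in> permute_vars \<sigma> ` I"
        using * by blast
    qed (use * in blast)
  qed
  then show ?thesis
    unfolding symmetric_def by blast
qed

lemma symmetric_strongly_shifted_Sss: "symmetric_strongly_shifted (Sss B)"
  unfolding Sss_def
proof (rule hull_in)
  fix T :: "('a, 'b) mpoly set set"
  assume "Ball T symmetric_strongly_shifted"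
  then show "symmetric_strongly_shifted (\<Inter> T)"
    unfolding symmetric_strongly_shifted_def monomial_ideal_iff symmetric_iff partitions_of_def
    by (auto intro!: poly_ideal.subspace_Inter)
qed

end

theory Submission
  imports Defs "HOL-Library.Cardinality"
begin

text \<open>
  For \<open>\<mu> \<in> Pn\<close>, the exponents of \<open>Sss {\<mu>}\<close> are the vectors \<open>u\<close> such that \<open>u(A)\<close> is, for every set
  \<open>A\<close> of variables, at least the sum \<open>g(A)\<close> of the \<open>card A\<close> smallest entries of \<open>\<mu>\<close>. Since \<open>g\<close> is
  supermodular, this is a contrapolymatroid, and its bases satisfy the exchange property by the usual
  uncrossing of tight sets. Conversely, in a symmetric polymatroidal ideal the minimal generator with
  the smallest prefix sums is increasing, and all other generators dominate it. For the existence of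
  partition Borel generators, note that domination is a well-founded order on \<open>Pn\<close>, so that the
  minimal elements of \<open>partitions_of I\<close> are the least generating set.
\<close>

section \<open>Exponents, prefix sums and domination\<close>

abbreviation lk :: "'n expo \<Rightarrow> 'n \<Rightarrow> nat"
  where "lk \<equiv> Poly_Mapping.lookup"

text \<open>Positions are counted from 0; beyond \<open>CARD('n)\<close> the value is unspecified,
  hence the range conditions in what follows.\<close>

definition nth_var :: "nat \<Rightarrow> 'n::{finite,linorder}"
  where "nth_var k = sorted_list_of_set UNIV ! k"

text \<open>For \<open>w\<close> in \<open>Pn\<close> this is the sum of the \<open>k\<close>
  smallest entries. Such prefix sums turn domination into a comparison of finitely many
  numbers.\<close>

definition psum :: "'n::{finite,linorder} expo \<Rightarrow> nat \<Rightarrow> nat"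
  where "psum w k = (\<Sum>j<k. lk w (nth_var j))"

definition dominators :: "'n::{finite,linorder} expo \<Rightarrow> 'n expo set"
  where "dominators \<mu> = {u. \<forall>A. psum \<mu> (card A) \<le> sum (lk u) A}"

definition exps :: "('n, 'k::field) mpoly set \<Rightarrow> 'n expo set"
  where "exps I = {m. xpow m \<in> I}"

text \<open>Inverse to \<open>exps\<close> on monomial ideals, so that these can be handled as
  upward closed sets of exponents.\<close>

definition polys_over :: "'n expo set \<Rightarrow> ('n, 'k::field) mpoly set"
  where "polys_over S = {f. Poly_Mapping.keys f \<subseteq> S}"

section \<open>Enumeration of the variables and sorting of exponents\<close>

lemma bij_betw_nth_var: "bij_betw (nth_var :: nat \<Rightarrow> 'n::{finite,linorder}) {..<CARD('n)} UNIV"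
  unfolding nth_var_def by (rule bij_betw_nth) auto

lemma nth_var_less:
  assumes "i < j" "j < CARD('n)"
  shows "(nth_var i :: 'n::{finite,linorder}) < nth_var j"
  unfolding nth_var_def
  using assms sorted_wrt_nth_less[of "(<)" "sorted_list_of_set (UNIV :: 'n set)" i j]
  by simp

lemma nth_var_cases:
  obtains k where "k < CARD('n)" "(i :: 'n::{finite,linorder}) = nth_var k"
  using bij_betw_nth_var unfolding bij_betw_def by (metis UNIV_I imageE lessThan_iff)

lemma nth_var_eq_iff:
  assumes "i < CARD('n)" "j < CARD('n)"
  shows "(nth_var i :: 'n::{finite,linorder}) = nth_var j \<longleftrightarrow> i = j"
  using assms bij_betw_nth_var[where 'n = 'n] unfolding bij_betw_def inj_on_def by blast

lemma nth_var_less_iff: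
  assumes "i < CARD('n)" "j < CARD('n)"
  shows "(nth_var i :: 'n::{finite,linorder}) < nth_var j \<longleftrightarrow> i < j"
  using assms nth_var_less[where 'n = 'n] by (metis less_asym linorder_neqE_nat order_less_irrefl)

lemma lookup_exchange:
  "lk (exchange m i j) k =
    lk m k + (if k = i then 1 else 0) - (if k = j then 1 else 0)"
  by (auto simp: exchange_def lookup_add lookup_minus lookup_single when_def)

lemma lookup_map_key: "bij \<sigma> \<Longrightarrow> lk (Poly_Mapping.map_key \<sigma> m) i = lk m (\<sigma> i)"
  by (simp add: map_key.rep_eq bij_is_inj)

lemma expo_le_iff: "(\<exists>a. u = v + a) \<longleftrightarrow> (\<forall>i. lk v i \<le> lk u i)"
proof
  assume *: "\<forall>i. lk v i \<le> lk u i"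
  have "u = v + (u - v)"
    by (rule poly_mapping_eqI) (use * in \<open>simp add: lookup_add lookup_minus\<close>)
  then show "\<exists>a. u = v + a" ..
qed (auto simp: lookup_add)

lemma expo_eqI_sum:
  fixes u v :: "'n::finite expo"
  assumes "\<And>i. lk v i \<le> lk u i" "deg u \<le> deg v"
  shows "v = u"
proof (rule poly_mapping_eqI, rule ccontr)
  fix i assume "lk v i \<noteq> lk u i"
  then have "(\<Sum>i\<in>UNIV. lk v i) < (\<Sum>i\<in>UNIV. lk u i)"
    using assms(1)[of i] by (intro sum_strict_mono_ex1) (auto simp: assms(1) order_less_le intro!: exI[of _ i])
  then show False using assms(2) by (simp add: deg_def)
qed

text \<open>Induction by removing the largest index of \<open>A\<close>. That index is at least
  \<open>card A - 1\<close>, so its value is at least the last summand on the left.\<close>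

lemma sum_mono_initial:
  fixes s :: "nat \<Rightarrow> nat"
  assumes "finite A" "A \<subseteq> {..<n}" "\<And>i j. i \<le> j \<Longrightarrow> j < n \<Longrightarrow> s i \<le> s j"
  shows "(\<Sum>j<card A. s j) \<le> sum s A"
  using assms(1,2)
proof (induction "card A" arbitrary: A)
  case 0
  then show ?case by auto
next
  case (Suc k)
  then have ne: "A \<noteq> {}" by auto
  have k: "k = card (A - {Max A})" using Suc ne by simp
  have "k \<le> Max A"
    using card_le_Suc_Max[OF Suc.prems(1)] Suc.hyps(2) by simp
  moreover have "Max A < n" using Suc.prems ne Max_in by blast
  ultimately have "s k \<le> s (Max A)" using assms(3) by simp
  moreover have "(\<Sum>j<k. s j) \<le> sum s (A - {Max A})"
    using Suc.hyps(1)[OF k] Suc.prems k by auto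
  moreover have "sum s A = s (Max A) + sum s (A - {Max A})"
    using Suc.prems ne by (simp add: sum.remove)
  ultimately show ?case using Suc.hyps(2)[symmetric] by simp
qed

lemma Pn_iff:
  fixes w :: "'n::{finite,linorder} expo"
  shows "w \<in> Pn \<longleftrightarrow>
    (\<forall>i j. i \<le> j \<longrightarrow> j < CARD('n) \<longrightarrow> lk w (nth_var i) \<le> lk w (nth_var j))"
proof
  assume "w \<in> Pn"
  then show "\<forall>i j. i \<le> j \<longrightarrow> j < CARD('n) \<longrightarrow> lk w (nth_var i) \<le> lk w (nth_var j)"
    unfolding Pn_def mono_def using nth_var_less[where 'n = 'n]
    by (metis (mono_tags, lifting) le_less mem_Collect_eq)
next
  assume *: "\<forall>i j. i \<le> j \<longrightarrow> j < CARD('n) \<longrightarrow> lk w (nth_var i) \<le> lk w (nth_var j)"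
  show "w \<in> Pn"
    unfolding Pn_def mem_Collect_eq
  proof (rule monoI)
    fix x y :: 'n
    assume "x \<le> y"
    obtain i j where "i < CARD('n)" "x = nth_var i" "j < CARD('n)" "y = nth_var j"
      using nth_var_cases by metis
    with \<open>x \<le> y\<close> * show "lk w x \<le> lk w y"
      using nth_var_less_iff[where 'n = 'n, of j i] by (metis linorder_not_le)
  qed
qed

lemma ex_sorting:
  fixes m :: "'n::{finite,linorder} expo"
  obtains \<sigma> :: "'n \<Rightarrow> 'n" where "bij \<sigma>" "Poly_Mapping.map_key \<sigma> m \<in> Pn"
proof -
  define ys where "ys = sort_key (lk m) (sorted_list_of_set (UNIV :: 'n set))"
  have ys: "distinct ys" "set ys = UNIV" "length ys = CARD('n)" "sorted (map (lk m) ys)"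
    by (auto simp: ys_def)
  \<comment> \<open>The variable in position \<open>k\<close> goes to the one holding the
    \<open>k\<close>-th smallest entry of \<open>m\<close>, so precomposition with this bijection
    lists the entries in increasing order.\<close>
  define \<sigma> where "\<sigma> = (\<lambda>i :: 'n. ys ! inv_into {..<CARD('n)} nth_var i)"
  have \<sigma>: "\<sigma> (nth_var k) = ys ! k" if "k < CARD('n)" for k
    unfolding \<sigma>_def using bij_betw_inv_into_left[OF bij_betw_nth_var[where 'n = 'n]] that by simp
  have "bij_betw ((!) ys) {..<CARD('n)} UNIV"
    using ys by (intro bij_betw_nth) auto
  from bij_betw_trans[OF bij_betw_inv_into[OF bij_betw_nth_var[where 'n = 'n]] this]
  have "bij \<sigma>" unfolding \<sigma>_def comp_def .
  moreover have "Poly_Mapping.map_key \<sigma> m \<in> Pn"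
    unfolding Pn_iff using sorted_nth_mono[OF ys(4)] ys(3)
    by (simp add: lookup_map_key \<open>bij \<sigma>\<close> \<sigma>)
  ultimately show ?thesis using that by blast
qed

lemma card_image_nth_var:
  assumes "B \<subseteq> {..<CARD('n)}"
  shows "card ((nth_var :: nat \<Rightarrow> 'n::{finite,linorder}) ` B) = card B"
    "sum f ((nth_var :: nat \<Rightarrow> 'n) ` B) = (\<Sum>j\<in>B. f (nth_var j))"
proof -
  have "inj_on (nth_var :: nat \<Rightarrow> 'n) B"
    using bij_betw_nth_var[where 'n = 'n] assms by (auto simp: bij_betw_def intro: inj_on_subset)
  then show "card ((nth_var :: nat \<Rightarrow> 'n) ` B) = card B"
    "sum f ((nth_var :: nat \<Rightarrow> 'n) ` B) = (\<Sum>j\<in>B. f (nth_var j))"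
    by (simp_all add: card_image sum.reindex)
qed

section \<open>The domination order\<close>

lemma psum_card: "psum w CARD('n) = deg (w :: 'n::{finite,linorder} expo)"
  unfolding psum_def deg_def using sum.reindex_bij_betw[OF bij_betw_nth_var[where 'n = 'n]] by simp

lemma psum_le_dominators:
  fixes u :: "'n::{finite,linorder} expo"
  assumes "u \<in> dominators \<mu>" "k \<le> CARD('n)"
  shows "psum \<mu> k \<le> psum u k"
proof -
  have "psum \<mu> (card (nth_var ` {..<k} :: 'n set)) \<le> sum (lk u) (nth_var ` {..<k})"
    using assms(1) unfolding dominators_def by blast
  then show ?thesis
    using assms(2) by (simp add: card_image_nth_var psum_def)
qed

text \<open>Initial segments suffice as test sets: when \<open>u\<close> is increasing, the first
  \<open>card A\<close> variables have the smallest sum among all sets of that size.\<close>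

lemma dominators_sortedI:
  fixes u :: "'n::{finite,linorder} expo"
  assumes "u \<in> Pn" "\<And>k. k \<le> CARD('n) \<Longrightarrow> psum \<mu> k \<le> psum u k"
  shows "u \<in> dominators \<mu>"
  unfolding dominators_def
proof clarify
  fix A :: "'n set"
  define B where "B = {k \<in> {..<CARD('n)}. nth_var k \<in> A}"
  have A: "A = nth_var ` B"
    unfolding B_def using bij_betw_nth_var[where 'n = 'n] by (fastforce simp: bij_betw_def)
  have B: "B \<subseteq> {..<CARD('n)}" "finite B" by (auto simp: B_def)
  have "psum u (card B) \<le> (\<Sum>j\<in>B. lk u (nth_var j))"
    unfolding psum_def using assms(1) B by (intro sum_mono_initial) (auto simp: Pn_iff)
  moreover have "card B \<le> CARD('n)"
    using card_mono[OF _ B(1)] by simp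
  ultimately show "psum \<mu> (card A) \<le> sum (lk u) A"
    using assms(2)[of "card B"] card_image_nth_var[OF B(1)] A by (metis le_trans)
qed

lemma self_dominators: "\<mu> \<in> Pn \<Longrightarrow> \<mu> \<in> dominators \<mu>"
  by (rule dominators_sortedI) auto

lemma dominators_trans:
  fixes u :: "'n::{finite,linorder} expo"
  assumes "u \<in> dominators \<mu>" "\<mu> \<in> dominators \<nu>"
  shows "u \<in> dominators \<nu>"
  unfolding dominators_def
proof clarify
  fix A :: "'n set"
  show "psum \<nu> (card A) \<le> sum (lk u) A"
    using psum_le_dominators[OF assms(2), of "card A"] assms(1) card_mono[of UNIV A]
    unfolding dominators_def by (metis (mono_tags, lifting) finite le_trans mem_Collect_eq subset_UNIV)
qed

lemma expo_eqI_psum: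
  fixes u v :: "'n::{finite,linorder} expo"
  assumes "\<And>k. k \<le> CARD('n) \<Longrightarrow> psum u k = psum v k"
  shows "u = v"
proof (rule poly_mapping_eqI)
  fix i :: 'n
  obtain k where k: "k < CARD('n)" "i = nth_var k" by (rule nth_var_cases)
  then show "lk u i = lk v i"
    using assms[of k] assms[of "Suc k"] by (simp add: psum_def)
qed

text \<open>A numerical measure, strictly increasing in the prefix sums; it serves to pick extremal
  exponents and as induction measure. It is small when the mass sits far to the right.\<close>

definition rank_sum :: "'n::{finite,linorder} expo \<Rightarrow> nat"
  where "rank_sum u = (\<Sum>k\<le>CARD('n). psum u k)"

lemma rank_sum_less:
  fixes u v :: "'n::{finite,linorder} expo"
  assumes "\<And>k. k \<le> CARD('n) \<Longrightarrow> psum u k \<le> psum v k" "u \<noteq> v"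
  shows "rank_sum u < rank_sum v"
proof -
  obtain k where "k \<le> CARD('n)" "psum u k \<noteq> psum v k"
    using assms(2) expo_eqI_psum by blast
  then show ?thesis
    unfolding rank_sum_def using assms(1) by (intro sum_strict_mono_ex1) (auto simp: order_less_le)
qed

lemma dominators_antisym:
  assumes "u \<in> dominators v" "v \<in> dominators u"
  shows "u = v"
  using expo_eqI_psum psum_le_dominators assms by (metis le_antisym)

section \<open>Closure of domination under permutations, multiples and exchanges\<close>

lemma dominators_map_key:
  assumes "u \<in> dominators \<mu>" "bij \<sigma>"
  shows "Poly_Mapping.map_key \<sigma> u \<in> dominators \<mu>"
  unfolding dominators_def
proof clarify
  fix A
  have "inj_on \<sigma> A" using assms(2) by (meson bij_is_inj inj_on_subset subset_UNIV)
  then have "card (\<sigma> ` A) = card A" "sum (lk u) (\<sigma> ` A) = sum (lk (Poly_Mapping.map_key \<sigma> u)) A"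
    by (simp_all add: card_image sum.reindex lookup_map_key assms(2))
  then show "psum \<mu> (card A) \<le> sum (lk (Poly_Mapping.map_key \<sigma> u)) A"
    using assms(1) unfolding dominators_def by (metis (mono_tags, lifting) mem_Collect_eq)
qed

lemma dominators_add: "u \<in> dominators \<mu> \<Longrightarrow> u + a \<in> dominators \<mu>"
  unfolding dominators_def by (auto simp: lookup_add sum.distrib intro: trans_le_add1)

text \<open>Indicators are added on both sides because subtraction on \<open>nat\<close>
  truncates.\<close>

lemma sum_exchange:
  fixes u :: "'n::finite expo"
  assumes "i \<noteq> j" "0 < lk u j"
  shows "sum (lk (exchange u i j)) A + (if j \<in> A then 1 else 0)
    = sum (lk u) A + (if i \<in> A then 1 else 0)"
proof -
  have *: "lk (exchange u i j) k + (if k = j then 1 else 0) = lk u k + (if k = i then 1 else 0)" for k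
    using assms by (auto simp: lookup_exchange)
  have "(\<Sum>k\<in>A. lk (exchange u i j) k + (if k = j then 1 else 0))
    = (\<Sum>k\<in>A. lk u k + (if k = i then 1 else 0))"
    unfolding * ..
  then show ?thesis by (simp add: sum.distrib)
qed

lemma deg_exchange:
  fixes u :: "'n::finite expo"
  assumes "i \<noteq> j" "0 < lk u j"
  shows "deg (exchange u i j) = deg u"
  using sum_exchange[OF assms, of UNIV] by (simp add: deg_def)

text \<open>The sum over \<open>A\<close> drops only if \<open>A\<close> contains \<open>j\<close>
  but not \<open>i\<close>, and then by one. Replacing \<open>j\<close> by \<open>i\<close> in
  \<open>A\<close> keeps the cardinality and lowers the sum of \<open>u\<close> by at least one, so
  the bound for the new set leaves enough room.\<close>

lemma dominators_exchange:
  fixes u :: "'n::{finite,linorder} expo"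
  assumes "u \<in> dominators \<mu>" "lk u i < lk u j"
  shows "exchange u i j \<in> dominators \<mu>"
  unfolding dominators_def
proof clarify
  fix A :: "'n set"
  have D: "psum \<mu> (card A) \<le> sum (lk u) A" for A
    using assms(1) unfolding dominators_def by blast
  have ij: "i \<noteq> j" "0 < lk u j" using assms(2) by auto
  show "psum \<mu> (card A) \<le> sum (lk (exchange u i j)) A"
  proof (cases "j \<in> A \<and> i \<notin> A")
    case True
    have "card (insert i (A - {j})) = card A"
      using True by (metis Diff_iff card.remove card_insert_disjoint finite)
    moreover have "sum (lk u) (insert i (A - {j})) = lk u i + sum (lk u) (A - {j})"
      using True by simp
    moreover have "sum (lk u) A = lk u j + sum (lk u) (A - {j})"
      using True by (simp add: sum.remove)
    ultimately show ?thesis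
      using D[of "insert i (A - {j})"] sum_exchange[OF ij, of A] True assms(2) by simp
  next
    case False
    then show ?thesis
      using D[of A] sum_exchange[OF ij, of A] by (auto split: if_splits)
  qed
qed

lemma psum_exchange:
  fixes w :: "'n::{finite,linorder} expo"
  assumes "k < CARD('n)" "l < CARD('n)" "k \<noteq> l" "0 < lk w (nth_var l)" "t \<le> CARD('n)"
  shows "psum (exchange w (nth_var k) (nth_var l)) t + (if l < t then 1 else 0)
    = psum w t + (if k < t then 1 else 0)"
proof -
  have "(nth_var k :: 'n) \<noteq> nth_var l" using assms nth_var_eq_iff by blast
  from sum_exchange[OF this assms(4), of "nth_var ` {..<t}"] show ?thesis
    using assms
    by (auto simp: psum_def card_image_nth_var image_iff nth_var_eq_iff split: if_splits)
qed

text \<open>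
  Among the elements of \<open>S\<close> whose prefix sums are at most those of \<open>u\<close>, one with largest
  \<open>rank_sum\<close> must be \<open>u\<close>: otherwise moving (or adding) a unit to the first position where it falls
  short of \<open>u\<close> gives a larger one.
\<close>

lemma dominators_generated:
  fixes S :: "'n::{finite,linorder} expo set"
  assumes up: "\<And>m a. m \<in> S \<Longrightarrow> m + a \<in> S"
    and ex: "\<And>m i j. m \<in> S \<Longrightarrow> lk m i < lk m j \<Longrightarrow> exchange m i j \<in> S"
    and "\<mu> \<in> S" "u \<in> Pn" "u \<in> dominators \<mu>"
  shows "u \<in> S"
proof -
  define T where "T = {w \<in> S. \<forall>k\<le>CARD('n). psum w k \<le> psum u k}"
  have "\<mu> \<in> T" unfolding T_def using assms(3,5) psum_le_dominators by blast
  moreover have "rank_sum w < Suc (rank_sum u)" if "w \<in> T" for w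
    using that unfolding T_def rank_sum_def less_Suc_eq_le by (intro sum_mono) auto
  ultimately obtain w where w: "w \<in> T" "\<And>y. y \<in> T \<Longrightarrow> rank_sum y \<le> rank_sum w"
    using ex_has_greatest_nat[of "\<lambda>w. w \<in> T" \<mu> rank_sum "Suc (rank_sum u)"] by blast
  have wS: "w \<in> S" and le: "\<And>k. k \<le> CARD('n) \<Longrightarrow> psum w k \<le> psum u k"
    using w(1) by (auto simp: T_def)
  have max: False if "y \<in> S" "\<And>k. k \<le> CARD('n) \<Longrightarrow> psum w k \<le> psum y k"
    "\<And>k. k \<le> CARD('n) \<Longrightarrow> psum y k \<le> psum u k" "y \<noteq> w" for y
    using rank_sum_less[OF that(2)] that w(2)[of y] by (auto simp: T_def)
  have "w = u"
  proof (rule ccontr)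
    assume "w \<noteq> u"
    then obtain k0 where "k0 < CARD('n)" "lk w (nth_var k0) \<noteq> lk u (nth_var k0)"
      by (metis nth_var_cases poly_mapping_eqI)
    then obtain k where k: "k < CARD('n)" "lk w (nth_var k) \<noteq> lk u (nth_var k)"
      and before: "\<And>j. j < k \<Longrightarrow> lk w (nth_var j) = lk u (nth_var j)"
      using exists_least_iff[of "\<lambda>k. k < CARD('n) \<and> lk w (nth_var k) \<noteq> lk u (nth_var k)"]
      by (metis less_trans)
    have "psum w k = psum u k" unfolding psum_def using before by simp
    with le[of "Suc k"] k have wk: "lk w (nth_var k) < lk u (nth_var k)"
      by (simp add: psum_def)
    show False
    proof (cases "\<exists>l>k. l \<le> CARD('n) \<and> psum w l = psum u l")
      \<comment> \<open>Here \<open>w\<close> never catches up with \<open>u\<close> after position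
        \<open>k\<close>, so all later prefix sums have room for an extra unit.\<close>
      case False
      let ?y = "w + Poly_Mapping.single (nth_var k) 1"
      have ps: "psum ?y l = psum w l + (if k < l then 1 else 0)" if "l \<le> CARD('n)" for l
      proof -
        have "psum ?y l = (\<Sum>j<l. lk w (nth_var j) + (if j = k then 1 else 0))"
          unfolding psum_def using that k(1)
          by (intro sum.cong) (auto simp: lookup_add lookup_single when_def nth_var_eq_iff)
        then show ?thesis by (simp add: sum.distrib psum_def)
      qed
      show False
      proof (rule max[of ?y])
        show "psum ?y l \<le> psum u l" if "l \<le> CARD('n)" for l
          using ps[OF that] le[OF that] False that by (auto simp: Suc_le_eq order_less_le)
        show "?y \<noteq> w" using ps[of "CARD('n)"] k(1) by auto
      qed (use up wS ps in auto)
    next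
      case True
      then obtain l0 where l0: "k < l0" "l0 \<le> CARD('n)" "psum w l0 = psum u l0"
        and first: "\<And>l. k < l \<Longrightarrow> l < l0 \<Longrightarrow> psum w l \<noteq> psum u l"
        using exists_least_iff[of "\<lambda>l. k < l \<and> l \<le> CARD('n) \<and> psum w l = psum u l"]
        by (metis less_imp_le_nat less_le_trans)
      \<comment> \<open>Position \<open>l\<close> is the last one before the first catch-up
        \<open>l0\<close>. The prefix sum of \<open>w\<close> is too small before it and equal after
        it, so \<open>w\<close> exceeds \<open>u\<close> there. Since \<open>u\<close> is
        increasing, the entry of \<open>w\<close> at \<open>k\<close> is below the one at
        \<open>l\<close>, and a unit may move from \<open>l\<close> to \<open>k\<close>.\<close>
      obtain l where l: "l0 = Suc l" using l0(1) by (metis gr0_implies_Suc less_nat_zero_code neq0_conv)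
      have "k \<noteq> l" using l0 \<open>psum w k = psum u k\<close> k(2) l by (auto simp: psum_def)
      then have kl: "k < l" "l < CARD('n)" using l0 l by auto
      have "psum w l < psum u l" using first[of l] le[of l] kl l by auto
      then have "lk u (nth_var l) < lk w (nth_var l)"
        using l0(3) unfolding l psum_def by simp
      moreover have "lk u (nth_var k) \<le> lk u (nth_var l)"
        using assms(4) kl by (simp add: Pn_iff)
      ultimately have lt: "lk w (nth_var k) < lk w (nth_var l)" using wk by simp
      let ?y = "exchange w (nth_var k) (nth_var l)"
      have ps: "psum ?y t + (if l < t then 1 else 0) = psum w t + (if k < t then 1 else 0)"
        if "t \<le> CARD('n)" for t
        using psum_exchange[of k l w t] k(1) kl lt that by simp
      show False
      proof (rule max[of ?y])
        show "?y \<in> S" using ex wS lt by blast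
        show "psum w t \<le> psum ?y t" if "t \<le> CARD('n)" for t
          using ps[OF that] kl by (auto split: if_splits)
        show "psum ?y t \<le> psum u t" if "t \<le> CARD('n)" for t
          using ps[OF that] kl le[OF that] first[of t] l by (auto split: if_splits)
        show "?y \<noteq> w" using ps[of l] kl by auto
      qed
    qed
  qed
  then show ?thesis using wS by simp
qed


section \<open>Monomial ideals as upward closed sets of exponents\<close>

lemma keys_xpow [simp]: "Poly_Mapping.keys (xpow m :: ('n, 'k::field) mpoly) = {m}"
  by (simp add: xpow_def)

lemma exps_polys_over [simp]: "exps (polys_over S) = S"
  by (simp add: exps_def polys_over_def)

lemma polys_over_exps:
  fixes I :: "('n, 'k::field) mpoly set"
  assumes "monomial_ideal I"
  shows "polys_over (exps I) = I"
proof
  have I: "is_ideal I" "\<forall>f\<in>I. \<forall>m\<in>Poly_Mapping.keys f. xpow m \<in> I"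
    using assms unfolding monomial_ideal_iff by auto
  show "I \<subseteq> polys_over (exps I)" using I(2) by (auto simp: polys_over_def exps_def)
  show "polys_over (exps I) \<subseteq> I"
  proof
    fix f :: "('n, 'k) mpoly"
    assume "f \<in> polys_over (exps I)"
    then have f: "xpow m \<in> I" if "m \<in> Poly_Mapping.keys f" for m
      using that by (auto simp: polys_over_def exps_def)
    \<comment> \<open>A polynomial is the sum of its terms; \<open>Poly_Mapping.single 0 c\<close>
      is the constant \<open>c\<close>.\<close>
    have "(\<Sum>m\<in>Poly_Mapping.keys f. Poly_Mapping.single 0 (Poly_Mapping.lookup f m) * xpow m) \<in> I"
      using I(1) f by (intro poly_ideal.subspace_sum poly_ideal.subspace_scale) auto
    also have "(\<Sum>m\<in>Poly_Mapping.keys f. Poly_Mapping.single 0 (Poly_Mapping.lookup f m) * xpow m) = f"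
      by (rule poly_mapping_eqI)
        (auto simp: xpow_def mult_single lookup_sum lookup_single when_def in_keys_iff)
    finally show "f \<in> I" .
  qed
qed

lemma exps_add:
  assumes "monomial_ideal I" "m \<in> exps I"
  shows "m + a \<in> exps I"
proof -
  have "xpow a * xpow m \<in> I"
    using assms by (auto simp: monomial_ideal_iff exps_def intro: poly_ideal.subspace_scale)
  then show ?thesis by (simp add: exps_def xpow_def mult_single add.commute)
qed

lemma exps_upward:
  assumes "monomial_ideal I" "v \<in> exps I" "\<And>i. lk v i \<le> lk u i"
  shows "u \<in> exps I"
  using exps_add[OF assms(1,2)] assms(3) expo_le_iff by metis

lemma monomial_ideal_polys_over:
  assumes "\<And>m a. m \<in> S \<Longrightarrow> m + a \<in> S"
  shows "monomial_ideal (polys_over S :: ('n, 'k::field) mpoly set)"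
proof -
  have "c * f \<in> polys_over S" if "f \<in> polys_over S" for c f :: "('n, 'k) mpoly"
  proof -
    have "a + b \<in> S" if "b \<in> Poly_Mapping.keys f" for a b
      using \<open>f \<in> polys_over S\<close> that assms[of b a] by (auto simp: polys_over_def add.commute)
    then show ?thesis using keys_mult[of c f] unfolding polys_over_def by blast
  qed
  moreover have "f + g \<in> polys_over S" if "f \<in> polys_over S" "g \<in> polys_over S"
    for f g :: "('n, 'k) mpoly"
    using that Poly_Mapping.keys_add[of f g] unfolding polys_over_def by blast
  ultimately show ?thesis
    unfolding monomial_ideal_iff poly_ideal.subspace_def
    by (auto simp: polys_over_def)
qed

section \<open>Symmetric ideals, strongly shifted hulls and Borel generators\<close>

lemma map_key_inverse:
  fixes m :: "'n expo"
  shows "bij \<sigma> \<Longrightarrow> Poly_Mapping.map_key (inv_into UNIV \<sigma>) (Poly_Mapping.map_key \<sigma> m) = m"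
  by (rule poly_mapping_eqI)
    (simp add: lookup_map_key bij_imp_bij_inv bij_is_surj surj_f_inv_f)

lemma symmetric_polys_over:
  assumes "\<And>\<sigma> m. bij \<sigma> \<Longrightarrow> m \<in> S \<Longrightarrow> Poly_Mapping.map_key \<sigma> m \<in> S"
  shows "symmetric (polys_over S :: ('n, 'k::field) mpoly set)"
proof -
  have key: "permute_vars \<sigma> f \<in> polys_over S \<longleftrightarrow> f \<in> polys_over S"
    if \<sigma>: "bij \<sigma>" for \<sigma> and f :: "('n, 'k) mpoly"
  proof -
    \<comment> \<open>The closure hypothesis for the inverse bijection gives the backward
      implication.\<close>
    have S: "Poly_Mapping.map_key \<sigma> m \<in> S \<longleftrightarrow> m \<in> S" for m
      using assms[OF \<sigma>, of m] assms[OF bij_imp_bij_inv[OF \<sigma>], of "Poly_Mapping.map_key \<sigma> m"]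
      by (metis map_key_inverse[OF \<sigma>])
    have surj: "m = Poly_Mapping.map_key \<sigma> (Poly_Mapping.map_key (inv_into UNIV \<sigma>) m)" for m :: "'n expo"
      using map_key_inverse[OF bij_imp_bij_inv[OF \<sigma>], of m] \<sigma> by (simp add: inv_inv_eq)
    have "(\<forall>m. Poly_Mapping.map_key \<sigma> m \<in> Poly_Mapping.keys f \<longrightarrow> m \<in> S)
      \<longleftrightarrow> (\<forall>m\<in>Poly_Mapping.keys f. m \<in> S)"
      using S surj by metis
    then show ?thesis
      by (auto simp: polys_over_def in_keys_iff lookup_permute_vars \<sigma>)
  qed
  then show ?thesis by (simp add: symmetric_iff)
qed

lemma exps_map_key:
  assumes "symmetric I" "bij \<sigma>"
  shows "Poly_Mapping.map_key \<sigma> m \<in> exps I \<longleftrightarrow> m \<in> exps I"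
proof -
  have "permute_vars \<sigma> (xpow (Poly_Mapping.map_key \<sigma> m)) = xpow m"
    using inj_map_key[OF assms(2)]
    by (intro poly_mapping_eqI)
      (simp add: lookup_permute_vars assms(2) xpow_def lookup_single when_def inj_eq)
  then show ?thesis using assms unfolding symmetric_iff exps_def by (metis mem_Collect_eq)
qed

text \<open>Shiftedness speaks only of increasing exponents and \<open>i < j\<close>. Sorting
  \<open>m\<close> reduces the general case to that one: in the sorted vector, the smaller entry
  necessarily comes first.\<close>

lemma exps_exchange:
  fixes I :: "('n::{finite,linorder}, 'k::field) mpoly set"
  assumes I: "symmetric_strongly_shifted I" and m: "m \<in> exps I" "lk m i < lk m j"
  shows "exchange m i j \<in> exps I"
proof -
  have sym: "symmetric I" using I by (simp add: symmetric_strongly_shifted_def)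
  obtain \<sigma> :: "'n \<Rightarrow> 'n" where \<sigma>: "bij \<sigma>" "Poly_Mapping.map_key \<sigma> m \<in> Pn"
      by (rule ex_sorting)
  let ?m = "Poly_Mapping.map_key \<sigma> m"
  obtain a b where ab: "i = \<sigma> a" "j = \<sigma> b" using surjD[OF bij_is_surj[OF \<sigma>(1)]] by blast
  have lt: "lk ?m a < lk ?m b" using m(2) by (simp add: ab lookup_map_key \<sigma>)
  have "\<not> b \<le> a"
    using \<sigma>(2) lt monoD[of "lk ?m" b a] by (auto simp: Pn_def)
  moreover have "?m \<in> partitions_of I"
    using m(1) \<sigma> exps_map_key[OF sym] by (auto simp: partitions_of_def exps_def)
  ultimately have "exchange ?m a b \<in> exps I"
    using I lt by (auto simp: symmetric_strongly_shifted_def exps_def)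
  moreover have "exchange ?m a b = Poly_Mapping.map_key \<sigma> (exchange m i j)"
    by (rule poly_mapping_eqI)
      (use bij_is_inj[OF \<sigma>(1)] in \<open>simp add: lookup_exchange lookup_map_key \<sigma> ab inj_eq\<close>)
  ultimately show ?thesis using exps_map_key[OF sym \<sigma>(1)] by metis
qed

text \<open>The right-hand side is a symmetric strongly shifted ideal containing the monomials of
  \<open>B\<close>, so it contains the hull. Conversely, \<open>dominators_generated\<close> reaches
  the sorted form of every dominator of a generator, and symmetry undoes the sorting.\<close>

lemma Sss_eq:
  fixes B :: "'n::{finite,linorder} expo set"
  assumes "B \<subseteq> Pn"
  shows "(Sss B :: ('n, 'k::field) mpoly set) = polys_over (\<Union>b\<in>B. dominators b)"
proof
  let ?U = "\<Union>b\<in>B. dominators b"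
  show "(Sss B :: ('n, 'k) mpoly set) \<subseteq> polys_over ?U"
    unfolding Sss_def
  proof (rule hull_minimal)
    show "symmetric_strongly_shifted (polys_over ?U :: ('n, 'k) mpoly set)"
      unfolding symmetric_strongly_shifted_def
    proof (intro conjI monomial_ideal_polys_over symmetric_polys_over)
      show "\<forall>\<mu>\<in>partitions_of (polys_over ?U :: ('n, 'k) mpoly set). \<forall>i j. i < j \<and> lk \<mu> i < lk \<mu> j
        \<longrightarrow> (xpow (exchange \<mu> i j) :: ('n, 'k) mpoly) \<in> polys_over ?U"
        using dominators_exchange by (fastforce simp: partitions_of_def polys_over_def)
    qed (auto intro: dominators_add dominators_map_key)
    show "(xpow ` B :: ('n, 'k) mpoly set) \<subseteq> polys_over ?U"
      using self_dominators[OF subsetD[OF assms]] by (auto simp: polys_over_def)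
  qed
  let ?J = "Sss B :: ('n, 'k) mpoly set"
  have J: "symmetric_strongly_shifted ?J" by (rule symmetric_strongly_shifted_Sss)
  then have mono: "monomial_ideal ?J" and sym: "symmetric ?J"
    by (auto simp: symmetric_strongly_shifted_def)
  have "u \<in> exps ?J" if b: "b \<in> B" "u \<in> dominators b" for u b
  proof -
    obtain \<sigma> :: "'n \<Rightarrow> 'n" where \<sigma>: "bij \<sigma>" "Poly_Mapping.map_key \<sigma> u \<in> Pn"
      by (rule ex_sorting)
    have "b \<in> exps ?J"
      using b(1) hull_subset[of "xpow ` B" symmetric_strongly_shifted]
      unfolding exps_def Sss_def by blast
    from dominators_generated[OF exps_add[OF mono] exps_exchange[OF J] this \<sigma>(2)]
    show ?thesis using dominators_map_key[OF b(2) \<sigma>(1)] exps_map_key[OF sym \<sigma>(1)] by blast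
  qed
  then have "?U \<subseteq> exps ?J" by blast
  then show "polys_over ?U \<subseteq> ?J"
    using polys_over_exps[OF mono] unfolding polys_over_def by blast
qed

text \<open>An antichain is the least generating set: if \<open>C\<close> generates the same ideal,
  each \<open>b\<close> in \<open>B\<close> dominates some \<open>c\<close> in \<open>C\<close>,
  which dominates some \<open>b'\<close> in \<open>B\<close>. The antichain condition gives
  \<open>b = b'\<close>, and antisymmetry then gives \<open>b = c\<close>.\<close>

lemma partition_Borel_generators_eqI:
  fixes I :: "('n::{finite,linorder}, 'k::field) mpoly set"
  assumes "B \<subseteq> Pn" "I = Sss B"
    and anti: "\<And>b c. b \<in> B \<Longrightarrow> c \<in> B \<Longrightarrow> b \<in> dominators c \<Longrightarrow> b = c"
  shows "partition_Borel_generators I = B"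
  unfolding partition_Borel_generators_def
proof (rule Least_equality)
  fix C assume C: "C \<subseteq> Pn \<and> I = Sss C"
  have "(\<Union>b\<in>B. dominators b) = exps I"
    unfolding assms(2) Sss_eq[OF assms(1)] by simp
  also have "\<dots> = (\<Union>c\<in>C. dominators c)"
    using Sss_eq[where 'k = 'k, of C] C by (metis exps_polys_over)
  finally have eq: "(\<Union>b\<in>B. dominators b) = (\<Union>c\<in>C. dominators c)" .
  show "B \<subseteq> C"
  proof
    fix b assume b: "b \<in> B"
    then have "b \<in> (\<Union>c\<in>C. dominators c)" using assms(1) self_dominators eq by blast
    then obtain c where c: "c \<in> C" "b \<in> dominators c" by blast
    then have "c \<in> (\<Union>b\<in>B. dominators b)" using C self_dominators eq by blast
    then obtain b' where b': "b' \<in> B" "c \<in> dominators b'" by blast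
    then have "b = b'" using anti b dominators_trans c(2) by blast
    then show "b \<in> C" using dominators_antisym c b'(2) by blast
  qed
qed (use assms in auto)

lemma symmetric_strongly_shifted_eq_Sss:
  fixes I :: "('n::{finite,linorder}, 'k::field) mpoly set"
  assumes I: "symmetric_strongly_shifted I"
  shows "I = Sss (partition_Borel_generators I)" "partition_Borel_generators I \<subseteq> Pn"
proof -
  define P where "P = partitions_of I"
  define B where "B = {b \<in> P. \<forall>c\<in>P. b \<in> dominators c \<longrightarrow> b = c}"
  have PPn: "P \<subseteq> Pn" by (auto simp: P_def partitions_of_def)
  then have BPn: "B \<subseteq> Pn" by (auto simp: B_def)
  have sym: "symmetric I" and mono: "monomial_ideal I"
    using I by (auto simp: symmetric_strongly_shifted_def)
  have "exps I \<subseteq> (\<Union>b\<in>B. dominators b)"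
  proof
    fix u assume "u \<in> exps I"
    obtain \<sigma> :: "'n \<Rightarrow> 'n" where \<sigma>: "bij \<sigma>" "Poly_Mapping.map_key \<sigma> u \<in> Pn"
      by (rule ex_sorting)
    let ?u = "Poly_Mapping.map_key \<sigma> u"
    have u: "?u \<in> P"
      using \<open>u \<in> exps I\<close> \<sigma> exps_map_key[OF sym] by (auto simp: P_def partitions_of_def exps_def)
    then have "?u \<in> P \<and> ?u \<in> dominators ?u" using \<sigma>(2) self_dominators by blast
    \<comment> \<open>Least \<open>rank_sum\<close> makes \<open>c\<close> minimal: a partition in
      \<open>P\<close> dominated by \<open>c\<close> is also dominated by \<open>?u\<close>, and
      would have smaller \<open>rank_sum\<close> unless equal to \<open>c\<close>.\<close>
    then obtain c where c: "c \<in> P" "?u \<in> dominators c"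
      and min: "\<And>d. d \<in> P \<Longrightarrow> ?u \<in> dominators d \<Longrightarrow> rank_sum c \<le> rank_sum d"
      using ex_has_least_nat[of "\<lambda>c. c \<in> P \<and> ?u \<in> dominators c" ?u rank_sum] by blast
    have "c = d" if "d \<in> P" "c \<in> dominators d" for d
      using min[OF that(1) dominators_trans[OF c(2) that(2)]] rank_sum_less[of d c]
        psum_le_dominators[OF that(2)] by fastforce
    then have "c \<in> B" using c(1) by (auto simp: B_def)
    moreover have "u \<in> dominators c"
      using dominators_map_key[OF c(2) bij_imp_bij_inv[OF \<sigma>(1)]] map_key_inverse[OF \<sigma>(1)] by metis
    ultimately show "u \<in> (\<Union>b\<in>B. dominators b)" by blast
  qed
  then have "I \<subseteq> Sss B"
    using polys_over_exps[OF mono] unfolding Sss_eq[OF BPn] polys_over_def by blast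
  moreover have "Sss B \<subseteq> I"
    unfolding Sss_def
    by (rule hull_minimal) (use I in \<open>auto simp: B_def P_def partitions_of_def\<close>)
  ultimately have eq: "I = Sss B" by blast
  moreover have "partition_Borel_generators I = B"
    by (rule partition_Borel_generators_eqI[OF BPn eq]) (auto simp: B_def)
  ultimately show "I = Sss (partition_Borel_generators I)" "partition_Borel_generators I \<subseteq> Pn"
    using BPn by simp_all
qed

section \<open>Minimal monomial generators\<close>

lemma min_gens_iff:
  fixes I :: "('n, 'k::field) mpoly set"
  shows "u \<in> min_gens I \<longleftrightarrow>
    u \<in> exps I \<and> (\<forall>v\<in>exps I. (\<forall>i. lk v i \<le> lk u i) \<longrightarrow> v = u)"
proof -
  have "(xpow v :: ('n, 'k) mpoly) dvd xpow u \<longleftrightarrow> (\<forall>i. lk v i \<le> lk u i)" for v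
  proof
    assume "(xpow v :: ('n, 'k) mpoly) dvd xpow u"
    then obtain f :: "('n, 'k) mpoly" where f: "xpow u = xpow v * f" by (elim dvdE)
    have "u \<in> Poly_Mapping.keys (xpow v * f)" unfolding f[symmetric] by simp
    then have "\<exists>a. u = v + a" using keys_mult[of "xpow v" f] by auto
    then show "\<forall>i. lk v i \<le> lk u i" unfolding expo_le_iff .
  next
    assume "\<forall>i. lk v i \<le> lk u i"
    then obtain a where "u = v + a" using expo_le_iff by metis
    then have "xpow u = xpow v * (xpow a :: ('n, 'k) mpoly)" by (simp add: xpow_def mult_single)
    then show "(xpow v :: ('n, 'k) mpoly) dvd xpow u" by simp
  qed
  then show ?thesis by (auto simp: min_gens_def exps_def)
qed

lemma ex_min_gen:
  fixes I :: "('n::finite, 'k::field) mpoly set"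
  assumes "u \<in> exps I"
  shows "\<exists>v\<in>min_gens I. \<forall>i. lk v i \<le> lk u i"
proof -
  obtain v where v: "v \<in> exps I" "\<And>i. lk v i \<le> lk u i"
    and min: "\<And>w. w \<in> exps I \<Longrightarrow> \<forall>i. lk w i \<le> lk u i \<Longrightarrow> deg v \<le> deg w"
    using ex_has_least_nat[of "\<lambda>v. v \<in> exps I \<and> (\<forall>i. lk v i \<le> lk u i)" u deg] assms by blast
  have "w = v" if "w \<in> exps I" "\<And>i. lk w i \<le> lk v i" for w
    using that v min[of w] expo_eqI_sum[of w v] le_trans by blast
  then have "v \<in> min_gens I" using v by (auto simp: min_gens_iff)
  then show ?thesis using v(2) by blast
qed

section \<open>Supermodularity, tight sets and base exchange\<close>

lemma psum_add: "psum w (a + k) = psum w a + (\<Sum>j<k. lk w (nth_var (a + j)))"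
  by (induction k) (auto simp: psum_def)

text \<open>Both \<open>c\<close> and \<open>b\<close> exceed \<open>a\<close> and \<open>d\<close>,
  respectively, by the same \<open>k\<close>. The two differences of prefix sums are sums over
  blocks of \<open>k\<close> consecutive entries, and the block starting further right is the
  larger.\<close>

lemma psum_supermodular:
  fixes \<mu> :: "'n::{finite,linorder} expo"
  assumes "\<mu> \<in> Pn" "a + b = c + d" "d \<le> a" "a \<le> c" "c \<le> CARD('n)"
  shows "psum \<mu> a + psum \<mu> b \<le> psum \<mu> c + psum \<mu> d"
proof -
  define k where "k = c - a"
  have eqs: "c = a + k" "b = d + k" using assms by (auto simp: k_def)
  have "(\<Sum>j<k. lk \<mu> (nth_var (d + j))) \<le> (\<Sum>j<k. lk \<mu> (nth_var (a + j)))"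
    using assms eqs(1) by (intro sum_mono) (auto simp: Pn_iff)
  then show ?thesis by (simp add: eqs psum_add)
qed

lemma psum_mono: "a \<le> b \<Longrightarrow> psum w a \<le> psum w b"
  unfolding psum_def by (rule sum_mono2) auto

text \<open>Uncrossing: the sum of \<open>u\<close> is modular, its lower bound is supermodular, so
  equality on \<open>A\<close> and \<open>B\<close> leaves no slack on union and
  intersection.\<close>

lemma tight_Un_Int:
  fixes u :: "'n::{finite,linorder} expo"
  assumes "\<mu> \<in> Pn" "u \<in> dominators \<mu>"
    and "sum (lk u) A = psum \<mu> (card A)" "sum (lk u) B = psum \<mu> (card B)"
  shows "sum (lk u) (A \<union> B) = psum \<mu> (card (A \<union> B))"
    "sum (lk u) (A \<inter> B) = psum \<mu> (card (A \<inter> B))"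
proof -
  have "psum \<mu> (card A) + psum \<mu> (card B) \<le> psum \<mu> (card (A \<union> B)) + psum \<mu> (card (A \<inter> B))"
    using assms(1)
    by (intro psum_supermodular) (auto simp: card_Un_Int[symmetric] intro!: card_mono)
  moreover have "sum (lk u) A + sum (lk u) B = sum (lk u) (A \<union> B) + sum (lk u) (A \<inter> B)"
    using sum.union_inter[of A B "lk u"] by simp
  moreover have "psum \<mu> (card C) \<le> sum (lk u) C" for C
    using assms(2) by (auto simp: dominators_def)
  note this[of "A \<union> B"] this[of "A \<inter> B"]
  ultimately show "sum (lk u) (A \<union> B) = psum \<mu> (card (A \<union> B))"
    "sum (lk u) (A \<inter> B) = psum \<mu> (card (A \<inter> B))"
    using assms(3,4) by linarith+
qed

text \<open>By minimality, every variable with positive exponent lies in a tight set. Its union with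
  a largest tight set \<open>T\<close> is again tight, hence equal to \<open>T\<close>. So
  \<open>u\<close> is supported on \<open>T\<close>, and tightness bounds its degree by that of the
  partition.\<close>

lemma deg_minimal_dominator:
  fixes u :: "'n::{finite,linorder} expo"
  assumes \<mu>: "\<mu> \<in> Pn" and u: "u \<in> dominators \<mu>"
    and min: "\<And>v. v \<in> dominators \<mu> \<Longrightarrow> \<forall>i. lk v i \<le> lk u i \<Longrightarrow> v = u"
  shows "deg u = deg \<mu>"
proof -
  define tight where "tight A \<longleftrightarrow> sum (lk u) A = psum \<mu> (card A)" for A
  have D: "psum \<mu> (card A) \<le> sum (lk u) A" for A
    using u by (auto simp: dominators_def)
  have "tight {}" by (simp add: tight_def psum_def)
  moreover have "card A < Suc CARD('n)" for A :: "'n set"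
    using card_mono[of UNIV A] by simp
  ultimately obtain T where T: "tight T" "\<And>A. tight A \<Longrightarrow> card A \<le> card T"
    using ex_has_greatest_nat[of tight "{}" card "Suc CARD('n)"] by blast
  have "lk u i = 0" if "i \<notin> T" for i
  proof (rule ccontr)
    assume pos: "lk u i \<noteq> 0"
    let ?v = "u - Poly_Mapping.single i 1"
    have *: "lk ?v k + (if k = i then 1 else 0) = lk u k" for k
      using pos by (auto simp: lookup_minus lookup_single when_def)
    have s: "sum (lk ?v) A + (if i \<in> A then 1 else 0) = sum (lk u) A" for A
    proof -
      have "(\<Sum>k\<in>A. lk ?v k + (if k = i then 1 else 0)) = sum (lk u) A"
        using * by (intro sum.cong) auto
      then show ?thesis by (simp add: sum.distrib)
    qed
    have "?v \<noteq> u" using *[of i] by auto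
    moreover have "lk ?v k \<le> lk u k" for k using *[of k] by (auto split: if_splits)
    ultimately have "?v \<notin> dominators \<mu>" using min by blast
    then obtain A where "\<not> psum \<mu> (card A) \<le> sum (lk ?v) A" by (auto simp: dominators_def)
    then have A: "tight A" "i \<in> A" using D[of A] s[of A] by (auto simp: tight_def split: if_splits)
    then have "tight (A \<union> T)" using tight_Un_Int(1)[OF \<mu> u] T(1) by (auto simp: tight_def)
    from T(2)[OF this] have "card (A \<union> T) \<le> card T" .
    then have "T = A \<union> T" by (intro card_seteq) auto
    then show False using A(2) that by blast
  qed
  then have "deg u = sum (lk u) T"
    unfolding deg_def by (intro sum.mono_neutral_right) auto
  also have "\<dots> \<le> psum \<mu> CARD('n)"
    using T(1) psum_mono[of "card T" "CARD('n)" \<mu>] card_mono[of UNIV T] by (simp add: tight_def)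
  finally have "deg u \<le> deg \<mu>" by (simp add: psum_card)
  moreover have "deg \<mu> \<le> deg u"
    using D[of UNIV] by (simp add: psum_card deg_def)
  ultimately show ?thesis by simp
qed

text \<open>
  The exchange partner is found in the smallest tight set containing \<open>i\<close>: \<open>v\<close> weighs at least
  as much as \<open>u\<close> on it, and every tight set containing \<open>i\<close> contains it.
\<close>

lemma dominators_base_exchange:
  fixes u v :: "'n::{finite,linorder} expo"
  assumes \<mu>: "\<mu> \<in> Pn" and u: "u \<in> dominators \<mu>" "deg u = deg \<mu>" and v: "v \<in> dominators \<mu>"
    and i: "lk v i < lk u i"
  shows "\<exists>j. lk u j < lk v j \<and> exchange u j i \<in> dominators \<mu>"
proof -
  define tight where "tight A \<longleftrightarrow> sum (lk u) A = psum \<mu> (card A)" for A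
  have "tight UNIV" using u(2) by (simp add: tight_def psum_card deg_def)
  then obtain T where T: "tight T" "i \<in> T" "\<And>A. tight A \<Longrightarrow> i \<in> A \<Longrightarrow> card T \<le> card A"
    using ex_has_least_nat[of "\<lambda>A. tight A \<and> i \<in> A" UNIV card] by blast
  have sub: "T \<subseteq> A" if "tight A" "i \<in> A" for A
  proof -
    have "tight (A \<inter> T)" using tight_Un_Int(2)[OF \<mu> u(1)] T(1) that by (auto simp: tight_def)
    then have "card T \<le> card (A \<inter> T)" using T that by blast
    then have "A \<inter> T = T" by (intro card_seteq) auto
    then show ?thesis by blast
  qed
  have "sum (lk u) T \<le> sum (lk v) T"
    using T(1) v by (auto simp: tight_def dominators_def)
  then obtain j where j: "j \<in> T" "lk u j < lk v j"
    using sum_strict_mono_ex1[of T "lk v" "lk u"] i T(2) by (meson finite linorder_not_less)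
  have ji: "j \<noteq> i" "0 < lk u i" using i j by auto
  have "exchange u j i \<in> dominators \<mu>"
    unfolding dominators_def
  proof clarify
    fix A :: "'n set"
    have "psum \<mu> (card A) \<le> sum (lk u) A" using u(1) by (auto simp: dominators_def)
    \<comment> \<open>Only sets containing \<open>i\<close> but not \<open>j\<close> lose a unit.
      They are not tight, hence have at least one unit to spare.\<close>
    moreover have "\<not> (tight A \<and> i \<in> A \<and> j \<notin> A)" using sub j by blast
    ultimately show "psum \<mu> (card A) \<le> sum (lk (exchange u j i)) A"
      using sum_exchange[OF ji, of A] by (auto simp: tight_def split: if_splits)
  qed
  then show ?thesis using j by blast
qed

lemma polymatroidal_Sss:
  fixes \<mu> :: "'n::{finite,linorder} expo"
  assumes \<mu>: "\<mu> \<in> Pn"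
  shows "polymatroidal (Sss {\<mu>} :: ('n, 'k::field) mpoly set)"
proof -
  let ?I = "Sss {\<mu>} :: ('n, 'k) mpoly set"
  have exps: "exps ?I = dominators \<mu>" using Sss_eq[where 'k = 'k, of "{\<mu>}"] \<mu> by simp
  have gens: "u \<in> dominators \<mu> \<and> deg u = deg \<mu>" if "u \<in> min_gens ?I" for u
    using that deg_minimal_dominator[OF \<mu>, of u] unfolding min_gens_iff exps by blast
  have "monomial_ideal ?I"
    using symmetric_strongly_shifted_Sss by (auto simp: symmetric_strongly_shifted_def)
  moreover have "\<exists>j. lk u j < lk v j \<and> xpow (exchange u j i) \<in> ?I"
    if "u \<in> min_gens ?I" "v \<in> min_gens ?I" "lk v i < lk u i" for u v i
    using dominators_base_exchange[OF \<mu>, of u v i] gens that exps by (auto simp: exps_def)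
  ultimately show ?thesis unfolding polymatroidal_def using gens by simp
qed

section \<open>Symmetric polymatroidal ideals as hulls of one partition\<close>

lemma deg_map_key:
  fixes m :: "'n::finite expo"
  assumes "bij \<sigma>"
  shows "deg (Poly_Mapping.map_key \<sigma> m) = deg m"
  using sum.reindex_bij_betw[OF assms, of "lk m"] by (simp add: deg_def lookup_map_key assms)

lemma polymatroidal_exchange:
  assumes "polymatroidal I" "u \<in> min_gens I" "v \<in> min_gens I" "lk v i < lk u i"
  shows "\<exists>j. lk u j < lk v j \<and> xpow (exchange u j i) \<in> I"
  using assms unfolding polymatroidal_def by blast

text \<open>Reduces the question whether a permuted or exchanged generator is again a generator to
  membership and degree.\<close>

lemma min_gens_polymatroidal:
  fixes I :: "('n::finite, 'k::field) mpoly set"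
  assumes "polymatroidal I" "w \<in> min_gens I"
  shows "min_gens I = {u \<in> exps I. deg u = deg w}"
proof (intro equalityI subsetI)
  have same_deg: "deg u = deg w" if "u \<in> min_gens I" for u
    using assms that unfolding polymatroidal_def by blast
  show "u \<in> {u \<in> exps I. deg u = deg w}" if "u \<in> min_gens I" for u
    using same_deg[OF that] that by (simp add: min_gens_iff)
  fix u assume "u \<in> {u \<in> exps I. deg u = deg w}"
  then have u: "u \<in> exps I" "deg u = deg w" by auto
  obtain v where v: "v \<in> min_gens I" "\<And>i. lk v i \<le> lk u i" using ex_min_gen[OF u(1)] by blast
  have "v = u" using expo_eqI_sum[of v u] v(2) u(2) same_deg[OF v(1)] by simp
  then show "u \<in> min_gens I" using v(1) by simp
qed

lemma bij_swap_vars: "bij (\<lambda>x. if x = a then b else if x = b then a else x)"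
  by (rule o_bij[where g = "\<lambda>x. if x = a then b else if x = b then a else x"]) auto

text \<open>Apply the exchange property to a generator \<open>u\<close> dividing the monomial and to
  its image under the transposition of \<open>i\<close> and \<open>j\<close>. They differ only in
  these two variables, so the partner of \<open>j\<close> can only be \<open>i\<close>.\<close>

lemma polymatroidal_imp_strongly_shifted:
  fixes I :: "('n::{finite,linorder}, 'k::field) mpoly set"
  assumes sym: "symmetric I" and pol: "polymatroidal I"
  shows "symmetric_strongly_shifted I"
proof -
  have mono: "monomial_ideal I" using pol by (simp add: polymatroidal_def)
  have "exchange m i j \<in> exps I" if m: "m \<in> exps I" and ij: "i \<noteq> j" "lk m i < lk m j" for m i j
  proof -
    obtain u where u: "u \<in> min_gens I" "\<And>k. lk u k \<le> lk m k" using ex_min_gen[OF m] by blast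
    show ?thesis
    proof (cases "lk u j < lk m j")
      \<comment> \<open>There is slack at \<open>j\<close>, so \<open>u\<close> still divides the
        exchanged monomial.\<close>
      case True
      have "lk u k \<le> lk (exchange m i j) k" for k
        using u(2)[of k] True by (auto simp: lookup_exchange)
      then show ?thesis using exps_upward[OF mono] u(1) by (auto simp: min_gens_iff)
    next
      case False
      then have ju: "lk u i < lk u j" using u(2)[of i] u(2)[of j] ij by simp
      let ?\<sigma> = "\<lambda>x. if x = i then j else if x = j then i else x"
      let ?v = "Poly_Mapping.map_key ?\<sigma> u"
      have v: "lk ?v k = lk u (?\<sigma> k)" for k using lookup_map_key[OF bij_swap_vars] .
      have "?v \<in> min_gens I"
        using u(1) unfolding min_gens_polymatroidal[OF pol u(1)]
        by (simp add: exps_map_key[OF sym bij_swap_vars] deg_map_key[OF bij_swap_vars] min_gens_iff)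
      then obtain k where k: "lk u k < lk ?v k" "xpow (exchange u k j) \<in> I"
        using polymatroidal_exchange[OF pol u(1), of ?v j] ju ij(1) v[of j] by auto
      then have "k = i" using v[of k] ju by (auto split: if_splits)
      then have "exchange u i j \<in> exps I" using k(2) by (simp add: exps_def)
      moreover have "lk (exchange u i j) k \<le> lk (exchange m i j) k" for k
        using u(2)[of k] by (auto simp: lookup_exchange)
      ultimately show ?thesis using exps_upward[OF mono] by blast
    qed
  qed
  then show ?thesis
    using sym mono by (auto simp: symmetric_strongly_shifted_def partitions_of_def exps_def)
qed

text \<open>
  The generator \<open>l\<close> with its mass as far to the right as possible (minimal \<open>rank_sum\<close>) has
  the smallest prefix sums: where another generator \<open>v\<close> first differs from it, \<open>v\<close> is larger, and
  exchanging there moves a unit of \<open>v\<close> to the right.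
\<close>

lemma polymatroidal_imp_Sss:
  fixes I :: "('n::{finite,linorder}, 'k::field) mpoly set"
  assumes sym: "symmetric I" and pol: "polymatroidal I" and "I \<noteq> {0}"
  shows "\<exists>\<mu>\<in>Pn. I = Sss {\<mu>}"
proof -
  have mono: "monomial_ideal I" using pol by (simp add: polymatroidal_def)
  have "0 \<in> I" using mono poly_ideal.subspace_0 by (auto simp: monomial_ideal_iff)
  \<comment> \<open>A nonzero polynomial in the ideal supplies an exponent, and thus a minimal
    generator.\<close>
  then obtain f where "f \<in> I" "f \<noteq> 0" using assms(3) by blast
  then have "exps I \<noteq> {}"
    using polys_over_exps[OF mono] by (auto simp: polys_over_def)
  then obtain w where w: "w \<in> min_gens I" using ex_min_gen by blast
  note gens = min_gens_polymatroidal[OF pol w]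
  obtain l where l: "l \<in> min_gens I" and least: "\<And>v. v \<in> min_gens I \<Longrightarrow> rank_sum l \<le> rank_sum v"
    using ex_has_least_nat[of "\<lambda>v. v \<in> min_gens I" w rank_sum] w by blast
  have move: "\<exists>v'\<in>min_gens I. rank_sum v' < rank_sum v \<and> (\<forall>t\<le>CARD('n). psum v' t \<le> psum v t)"
    if v: "v \<in> min_gens I" "u \<in> min_gens I" and k: "k < CARD('n)" "lk u (nth_var k) < lk v (nth_var k)"
      and before: "\<And>j. j < k \<Longrightarrow> lk u (nth_var j) = lk v (nth_var j)" for u v k
  proof -
    obtain x where x: "lk v x < lk u x" "xpow (exchange v x (nth_var k)) \<in> I"
      using polymatroidal_exchange[OF pol v k(2)] by blast
    obtain j where j: "j < CARD('n)" "x = nth_var j" by (rule nth_var_cases)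
    \<comment> \<open>The partner lies to the right: before \<open>k\<close> the two generators
      agree, and at \<open>k\<close> the inequality is reversed.\<close>
    have "k < j" using before[of j] x(1) k(2) j(2) by (metis less_asym nat_neq_iff less_irrefl)
    let ?v = "exchange v (nth_var j) (nth_var k)"
    have "(nth_var j :: 'n) \<noteq> nth_var k" using \<open>k < j\<close> j(1) k(1) nth_var_eq_iff by blast
    then have "deg ?v = deg v" using k(2) by (intro deg_exchange) auto
    then have "?v \<in> min_gens I" using v(1) x(2) j(2) unfolding gens by (simp add: exps_def)
    moreover have ps: "psum ?v t + (if k < t then 1 else 0) = psum v t + (if j < t then 1 else 0)"
      if "t \<le> CARD('n)" for t
      using psum_exchange[of j k v t] j k \<open>k < j\<close> that by simp
    moreover have le: "psum ?v t \<le> psum v t" if "t \<le> CARD('n)" for t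
      using ps[OF that] \<open>k < j\<close> by (auto split: if_splits)
    moreover have "?v \<noteq> v" using ps[of j] \<open>k < j\<close> j(1) by auto
    ultimately show ?thesis using rank_sum_less[of ?v v] by blast
  qed
  have first: "lk l (nth_var k) < lk v (nth_var k)"
    if "v \<in> min_gens I" "k < CARD('n)" "lk l (nth_var k) \<noteq> lk v (nth_var k)"
      "\<And>j. j < k \<Longrightarrow> lk l (nth_var j) = lk v (nth_var j)" for v k
  proof (rule ccontr)
    assume "\<not> ?thesis"
    then have "lk v (nth_var k) < lk l (nth_var k)" using that(3) by simp
    then show False using move[OF l that(1,2)] that(4) least by (metis linorder_not_le)
  qed
  \<comment> \<open>If \<open>l\<close> had a descent from \<open>i\<close> to \<open>j\<close>,
    swapping the two entries would give a generator whose first difference from \<open>l\<close> is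
    at \<open>i\<close>, with a smaller entry there, against \<open>first\<close>.\<close>
  have "l \<in> Pn"
    unfolding Pn_iff
  proof (intro allI impI, rule ccontr)
    fix i j assume ij: "i \<le> j" "j < CARD('n)" "\<not> lk l (nth_var i) \<le> lk l (nth_var j)"
    let ?\<sigma> = "\<lambda>x :: 'n. if x = nth_var i then nth_var j else if x = nth_var j then nth_var i else x"
    let ?v = "Poly_Mapping.map_key ?\<sigma> l"
    have v: "lk ?v k = lk l (?\<sigma> k)" for k using lookup_map_key[OF bij_swap_vars] .
    have "?v \<in> min_gens I"
      using l unfolding gens
      by (simp add: exps_map_key[OF sym bij_swap_vars] deg_map_key[OF bij_swap_vars])
    moreover have "lk l (nth_var t) = lk ?v (nth_var t)" if "t < i" for t
      unfolding v using that ij by (simp add: nth_var_eq_iff)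
    ultimately have "lk l (nth_var i) < lk ?v (nth_var i)"
      using ij v[of "nth_var i"] by (intro first) auto
    then show False using ij v[of "nth_var i"] by simp
  qed
  have prefix: "psum l t \<le> psum v t" if v: "v \<in> min_gens I" and t: "t \<le> CARD('n)" for v t
    using v
  \<comment> \<open>As long as \<open>v\<close> differs from \<open>l\<close>, \<open>move\<close>
    gives a generator of smaller \<open>rank_sum\<close> whose prefix sums are no larger.\<close>
  proof (induction "rank_sum v" arbitrary: v rule: less_induct)
    case less
    show ?case
    proof (cases "v = l")
      case False
      then obtain k0 where "k0 < CARD('n)" "lk l (nth_var k0) \<noteq> lk v (nth_var k0)"
        by (metis nth_var_cases poly_mapping_eqI)
      then obtain k where k: "k < CARD('n)" "lk l (nth_var k) \<noteq> lk v (nth_var k)"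
        and before: "\<And>j. j < k \<Longrightarrow> lk l (nth_var j) = lk v (nth_var j)"
        using exists_least_iff[of "\<lambda>k. k < CARD('n) \<and> lk l (nth_var k) \<noteq> lk v (nth_var k)"]
        by (metis less_trans)
      obtain v' where "v' \<in> min_gens I" "rank_sum v' < rank_sum v" "psum v' t \<le> psum v t"
        using move[OF less.prems l k(1) first[OF less.prems k before] before] t by blast
      then show ?thesis using less.hyps[of v'] by simp
    qed simp
  qed
  have "exps I \<subseteq> dominators l"
  proof
    fix u assume "u \<in> exps I"
    then obtain v where v: "v \<in> min_gens I" "\<And>i. lk v i \<le> lk u i" using ex_min_gen by blast
    \<comment> \<open>Prefix sums decide domination only for increasing vectors, so \<open>v\<close>
      is sorted first and then permuted back.\<close>
    obtain \<sigma> :: "'n \<Rightarrow> 'n" where \<sigma>: "bij \<sigma>" "Poly_Mapping.map_key \<sigma> v \<in> Pn"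
      by (rule ex_sorting)
    have "Poly_Mapping.map_key \<sigma> v \<in> min_gens I"
      using v(1) unfolding gens by (simp add: exps_map_key[OF sym \<sigma>(1)] deg_map_key[OF \<sigma>(1)])
    then have "Poly_Mapping.map_key \<sigma> v \<in> dominators l"
      using \<sigma>(2) prefix by (intro dominators_sortedI) auto
    then have "v \<in> dominators l"
      using dominators_map_key[OF _ bij_imp_bij_inv[OF \<sigma>(1)]] map_key_inverse[OF \<sigma>(1)] by metis
    moreover obtain a where "u = v + a" using v(2) expo_le_iff by metis
    ultimately show "u \<in> dominators l" using dominators_add by blast
  qed
  then have "I \<subseteq> Sss {l}"
    using polys_over_exps[OF mono] \<open>l \<in> Pn\<close> Sss_eq[where 'k = 'k, of "{l}"]
    by (auto simp: polys_over_def)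
  moreover have "Sss {l} \<subseteq> I"
    unfolding Sss_def
    by (rule hull_minimal)
      (use l polymatroidal_imp_strongly_shifted[OF sym pol] in \<open>auto simp: min_gens_iff exps_def\<close>)
  ultimately show ?thesis using \<open>l \<in> Pn\<close> by blast
qed

section \<open>The characterization by one Borel generator\<close>

theorem theorem3:
  fixes I :: "('n::{finite,linorder}, 'k::field) mpoly set"
  assumes "monomial_ideal I" and "I \<noteq> {0}" and "I \<noteq> UNIV"
  shows "(symmetric I \<and> polymatroidal I \<longleftrightarrow>
           symmetric_strongly_shifted I \<and> card (partition_Borel_generators I) = 1) \<and>
         (symmetric_strongly_shifted I \<and> card (partition_Borel_generators I) = 1 \<longleftrightarrow>
           (\<exists>\<mu>\<in>Pn. I = Sss {\<mu>}))"
proof -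
  have "symmetric I \<and> polymatroidal I" if "\<mu> \<in> Pn" "I = Sss {\<mu>}" for \<mu>
    using that polymatroidal_Sss symmetric_strongly_shifted_Sss
    by (auto simp: symmetric_strongly_shifted_def)
  moreover have "symmetric_strongly_shifted I \<and> card (partition_Borel_generators I) = 1"
    if "\<mu> \<in> Pn" "I = Sss {\<mu>}" for \<mu>
    using partition_Borel_generators_eqI[OF _ that(2)] symmetric_strongly_shifted_Sss that by auto
  moreover have "\<exists>\<mu>\<in>Pn. I = Sss {\<mu>}"
    if "symmetric_strongly_shifted I" "card (partition_Borel_generators I) = 1"
    using symmetric_strongly_shifted_eq_Sss[OF that(1)] that(2) by (metis card_1_singletonE insert_subset)
  ultimately show ?thesis using polymatroidal_imp_Sss assms(2) by blast
qed

end
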